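(* Let $p$ be odd, in the even weight, even dimension case (type (D)). The dimension of $\mathfrak g^{-p,p}$ for $0<p<m$ is $$\dim\mathfrak g^{-p,p}=\sum_{j=0}^{m-p-1}f_{j+p}f_j+\tfrac12f_mf_{m-p}+\tfrac12f_mf_{m-p}+\tfrac12\sum_{j=m-p+1}^{m-1}f_{n-j-p}f_j,$$ and for $p>m$ it is $$\dim\mathfrak g^{-p,p}=\tfrac12\sum_{j=0}^{n-p}f_{n-p-j}f_j.$$
   Context: $V$ is a real vector space of even dimension $2l$ with a polarised Hodge structure of even weight $n=2m$, $V_{\mathbb C}=\bigoplus_{a+b=n}V^{a,b}$, with Hodge numbers $f_i:=h^{n-i,i}=\dim V^{n-i,i}$; the polarisation $Q$ is symmetric and $\mathfrak g=\mathfrak{so}(2l,\mathbb C)$ is the Lie algebra of infinitesimal isometries of $Q$ on $V_{\mathbb C}$. $\mathfrak g^{-p,p}$ is the space of $g\in\mathfrak g$ with $g(V^{a,b})\subset V^{a-p,b+p}$ for all $a+b=n$.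
   Formalization: The Hodge structure is assumed effective (V^{a,b}=0 unless a,b≥0), as the sums from j=0 presuppose; without this the formula fails, e.g. n=0, p=1, h^{1,-1}=h^{-1,1}=1, h^{0,0}=2, where dim g^{-1,1}=2 but the sum is empty. *)

theory Defs
  imports "HOL-Analysis.Analysis" "HOL-Library.Function_Algebras"
begin

text \<open>
  The complexification of a real vector space \<open>'v\<close> is carried by the type \<open>'v \<times> 'v\<close>, where
  the pair \<open>(x, y)\<close> stands for \<open>x + i y\<close>. There is no type class of complex vector spaces, so
  the complex structure is an interpretation of the locale \<open>vector_space\<close>.
\<close>

definition cscale :: "complex \<Rightarrow> 'v \<times> 'v \<Rightarrow> 'v::real_vector \<times> 'v" where
  "cscale c z = (Re c *\<^sub>R fst z - Im c *\<^sub>R snd z, Re c *\<^sub>R snd z + Im c *\<^sub>R fst z)"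

global_interpretation cplx: vector_space cscale
  by unfold_locales (auto simp: cscale_def algebra_simps prod_eq_iff)

definition cconj :: "'v \<times> 'v \<Rightarrow> 'v::real_vector \<times> 'v" where
  "cconj z = (fst z, - snd z)"

text \<open>The complex bilinear extension of a real bilinear form.\<close>

definition bilin_ext :: "('v \<Rightarrow> 'v \<Rightarrow> real) \<Rightarrow> 'v \<times> 'v \<Rightarrow> 'v::real_vector \<times> 'v \<Rightarrow> complex" where
  "bilin_ext Q z w =
     Complex (Q (fst z) (fst w) - Q (snd z) (snd w)) (Q (fst z) (snd w) + Q (snd z) (fst w))"

definition fscale :: "complex \<Rightarrow> ('a \<Rightarrow> 'v \<times> 'v) \<Rightarrow> 'a \<Rightarrow> 'v::real_vector \<times> 'v" where
  "fscale c g = (\<lambda>x. cscale c (g x))"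

global_interpretation cfun: vector_space fscale
  by unfold_locales (auto simp: fscale_def fun_eq_iff cplx.scale_right_distrib cplx.scale_left_distrib)

definition fin_dim :: "'v::real_vector itself \<Rightarrow> bool" where
  "fin_dim _ \<longleftrightarrow> (\<exists>B :: 'v set. finite B \<and> span B = UNIV)"

text \<open>
  A Hodge structure of weight \<open>n\<close>: the components \<open>H a b\<close> with \<open>a + b = n\<close> are complex
  subspaces, exchanged by complex conjugation, and the complexification is their direct sum.
  Only the components with \<open>a + b = n\<close> matter.
\<close>

definition hodge_structure :: "int \<Rightarrow> (int \<Rightarrow> int \<Rightarrow> ('v::real_vector \<times> 'v) set) \<Rightarrow> bool" where
  "hodge_structure n H \<longleftrightarrow>
     (\<forall>a b. a + b = n \<longrightarrow> cplx.subspace (H a b)) \<and>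
     (\<forall>a b. a + b = n \<longrightarrow> cconj ` H a b = H b a) \<and>
     (\<forall>z. \<exists>!c. (\<forall>a. c a \<in> H a (n - a)) \<and> finite {a. c a \<noteq> 0} \<and> z = (\<Sum>a | c a \<noteq> 0. c a))"

text \<open>All Hodge types \<open>(a, b)\<close> that occur have \<open>a, b \<ge> 0\<close>.\<close>

definition effective :: "int \<Rightarrow> (int \<Rightarrow> int \<Rightarrow> ('v::real_vector \<times> 'v) set) \<Rightarrow> bool" where
  "effective n H \<longleftrightarrow> (\<forall>a b. a + b = n \<and> (a < 0 \<or> b < 0) \<longrightarrow> H a b = {0})"

text \<open>
  A polarisation is a real bilinear form, symmetric or alternating according to the parity of
  the weight, that satisfies the two Hodge-Riemann relations; its nondegeneracy is a consequence.
  Another common normalisation of the second relation replaces \<open>Q\<close> by \<open>- Q\<close> in certain weights,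
  which does not change the Lie algebra of infinitesimal isometries.
\<close>

definition polarisation ::
  "int \<Rightarrow> (int \<Rightarrow> int \<Rightarrow> ('v::real_vector \<times> 'v) set) \<Rightarrow> ('v \<Rightarrow> 'v \<Rightarrow> real) \<Rightarrow> bool" where
  "polarisation n H Q \<longleftrightarrow>
     bilinear Q \<and>
     (\<forall>x y. Q y x = (-1) powi n * Q x y) \<and>
     (\<forall>a b c d. a + b = n \<and> c + d = n \<and> (c, d) \<noteq> (b, a) \<longrightarrow>
        (\<forall>z\<in>H a b. \<forall>w\<in>H c d. bilin_ext Q z w = 0)) \<and>
     (\<forall>a b. a + b = n \<longrightarrow> (\<forall>z\<in>H a b. z \<noteq> 0 \<longrightarrow>
        \<i> powi (a - b) * bilin_ext Q z (cconj z) \<in> \<real> \<and>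
        Re (\<i> powi (a - b) * bilin_ext Q z (cconj z)) > 0))"

text \<open>The Hodge numbers \<open>f i = dim (H (n - i) i)\<close>.\<close>

definition hodge_number :: "int \<Rightarrow> (int \<Rightarrow> int \<Rightarrow> ('v::real_vector \<times> 'v) set) \<Rightarrow> int \<Rightarrow> nat" where
  "hodge_number n H i = cplx.dim (H (n - i) i)"

text \<open>The infinitesimal isometries of the complexified form.\<close>

definition isom_algebra ::
  "('v \<Rightarrow> 'v \<Rightarrow> real) \<Rightarrow> ('v \<times> 'v \<Rightarrow> 'v::real_vector \<times> 'v) set" where
  "isom_algebra Q =
     {g. Vector_Spaces.linear cscale cscale g \<and>
         (\<forall>z w. bilin_ext Q (g z) w + bilin_ext Q z (g w) = 0)}"

definition isom_component ::
  "int \<Rightarrow> (int \<Rightarrow> int \<Rightarrow> ('v::real_vector \<times> 'v) set) \<Rightarrow> ('v \<Rightarrow> 'v \<Rightarrow> real) \<Rightarrow> int \<Rightarrow>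
     ('v \<times> 'v \<Rightarrow> 'v \<times> 'v) set" where
  "isom_component n H Q p =
     {g \<in> isom_algebra Q. \<forall>a b. a + b = n \<longrightarrow> g ` H a b \<subseteq> H (a - p) (b + p)}"

end

theory Submission
  imports Defs
begin

text \<open>
  Write \<open>V i = H (n - i) i\<close>, so that an operator of type \<open>(-p, p)\<close> maps \<open>V i\<close> to \<open>V (i + p)\<close>, and
  let \<open>\<beta>\<close> be the complexified form. The form is symmetric because \<open>n\<close> is even, it pairs \<open>V i\<close> only
  with \<open>V (n - i)\<close>, and it is nondegenerate because of the second Hodge-Riemann relation. For such
  a form the infinitesimal isometries are \<open>\<Lambda>\<^sup>2\<close> of the vector space: \<open>u \<and> v\<close> acts as the elementary
  isometry \<open>x \<mapsto> \<beta> u x v - \<beta> v x u\<close>. If \<open>u \<in> V i\<close> and \<open>v \<in> V j\<close>, this operator has degree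
  \<open>i + j - n\<close>, so the component of degree \<open>p\<close> is the sum of the \<open>V i \<otimes> V j\<close> over the unordered
  pairs \<open>{i, j}\<close> with \<open>i + j = n + p\<close>. Here parity enters: \<open>n + p\<close> is odd, hence \<open>i \<noteq> j\<close>, no term
  \<open>\<Lambda>\<^sup>2 (V i)\<close> occurs, and twice the dimension is the sum of \<open>f\<^sub>i f\<^sub>j\<close> over ordered pairs.

  To make this precise, \<open>adapted_basis_exists\<close> gives a homogeneous basis \<open>E\<close> of the complexification
  and a dual family \<open>d\<close>. The elementary isometries of pairs from \<open>E\<close> in increasing degree are a
  basis of the component, because the coordinate of \<open>g\<close> at \<open>(u, v)\<close> can be read off as
  \<open>\<beta> (g (d u)) (d v)\<close> (\<open>dim_isom_component_eq_pairs\<close>). Counting pairs by degree gives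
  \<open>twice_dim_isom_component\<close>, and Hodge symmetry \<open>f\<^sub>i = f\<^bsub>n-i\<^esub>\<close> turns it into
  \<open>dim_isom_component\<close>, which is one formula for all odd \<open>p > 0\<close>. For \<open>p < m\<close> the stated expression
  is that formula cut at \<open>j = m - p\<close> and \<open>j = m\<close>; the reflection \<open>j \<mapsto> n - p - j\<close> exchanges the two
  outer ranges, which is why the first sum has no factor \<open>1/2\<close> (\<open>reflected_sum_split\<close>).
\<close>

section \<open>Biorthogonal systems\<close>

lemma sum_fun_apply: "(\<Sum>i\<in>I. g i) x = (\<Sum>i\<in>I. g i x)"
  for g :: "'i \<Rightarrow> 'x \<Rightarrow> 'y::comm_monoid_add"
  by (induction I rule: infinite_finite_induct) (auto simp: plus_fun_def zero_fun_def)

text \<open>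
  Linear functionals that take the values of a Kronecker delta on a spanning family force this
  family to be injective and independent, so that its indices count the dimension. Indexing the
  family matters below, where the vectors are operators and the indices are pairs of basis vectors.
\<close>

lemma (in vector_space) dim_eq_card_of_coordinates:
  assumes fin: "finite I"
    and mem: "\<And>i. i \<in> I \<Longrightarrow> r i \<in> S"
    and spans: "S \<subseteq> span (r ` I)"
    and lin: "\<And>i. Vector_Spaces.linear scale (*) (\<phi> i)"
    and coord: "\<And>i j. i \<in> I \<Longrightarrow> j \<in> I \<Longrightarrow> \<phi> i (r j) = (if i = j then 1 else 0)"
  shows "dim S = card I"
proof (rule dim_unique)
  show "r ` I \<subseteq> S" using mem by auto
  show "S \<subseteq> span (r ` I)" by (rule spans)
  have inj: "inj_on r I"
  proof (rule inj_onI)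
    fix i j assume "i \<in> I" "j \<in> I" "r i = r j"
    then show "i = j"
      using coord[of i i] coord[of i j] by (auto split: if_splits)
  qed
  then show "card (r ` I) = card I" by (rule card_image)
  show "independent (r ` I)"
  proof (rule independent_if_scalars_zero)
    show "finite (r ` I)" using fin by simp
    fix c x assume zero: "(\<Sum>x\<in>r ` I. scale (c x) x) = 0" and "x \<in> r ` I"
    then obtain i where i: "i \<in> I" "x = r i" by auto
    have hom: "module_hom scale (*) (\<phi> i)"
      using lin[of i] by (simp add: Vector_Spaces.linear_def)
    have "0 = \<phi> i (\<Sum>j\<in>I. scale (c (r j)) (r j))"
      using zero by (simp add: sum.reindex[OF inj] module_hom.zero[OF hom])
    also have "\<dots> = (\<Sum>j\<in>I. c (r j) * \<phi> i (r j))"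
      by (simp add: module_hom.sum[OF hom] module_hom.scale[OF hom])
    also have "\<dots> = (\<Sum>j\<in>I. if j = i then c (r i) else 0)"
      using i coord by (intro sum.cong) auto
    also have "\<dots> = c x" using i fin by simp
    finally show "c x = 0" by simp
  qed
qed

locale bilinear_form = vector_space scale
  for scale :: "'a::field \<Rightarrow> 'b::ab_group_add \<Rightarrow> 'b" +
  fixes b :: "'b \<Rightarrow> 'b \<Rightarrow> 'a"
  assumes linear_left: "Vector_Spaces.linear scale (*) (\<lambda>x. b x y)"
    and linear_right: "Vector_Spaces.linear scale (*) (b x)"
begin

lemma add_left: "b (x + y) z = b x z + b y z"
  and scale_left: "b (scale c x) z = c * b x z"
  using linear_left[of z] by (simp_all add: Vector_Spaces.linear_iff)

lemma add_right: "b z (x + y) = b z x + b z y"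
  and scale_right: "b z (scale c x) = c * b z x"
  using linear_right[of z] by (simp_all add: Vector_Spaces.linear_iff)

lemma zero_left [simp]: "b 0 z = 0" and zero_right [simp]: "b z 0 = 0"
  using scale_left[of 0 0 z] scale_right[of z 0 0] by simp_all

lemma diff_left: "b (x - y) z = b x z - b y z"
  using add_left[of "x - y" y z] by simp

lemma diff_right: "b z (x - y) = b z x - b z y"
  using add_right[of z "x - y" y] by simp

lemma sum_left: "b (\<Sum>i\<in>I. g i) z = (\<Sum>i\<in>I. b (g i) z)"
  by (induction I rule: infinite_finite_induct) (auto simp: add_left)

lemma sum_right: "b z (\<Sum>i\<in>I. g i) = (\<Sum>i\<in>I. b z (g i))"
  by (induction I rule: infinite_finite_induct) (auto simp: add_right)

lemmas bilinear_simps = add_left add_right scale_left scale_right diff_left diff_right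

lemma zero_on_span:
  assumes "\<And>u. u \<in> S \<Longrightarrow> b u y = 0" and "x \<in> span S"
  shows "b x y = 0"
  using assms(2) by (induction rule: span_induct_alt) (auto simp: bilinear_simps assms(1))

text \<open>
  The vectors of \<open>S\<close> only have to be separated by a subspace \<open>W\<close>; the dual family is then found
  inside \<open>W\<close>. With \<open>S\<close> a basis of \<open>V i\<close> and \<open>W = V (n - i)\<close> this makes the dual vectors
  homogeneous. The induction is a Gram-Schmidt step: correct the new vector \<open>s\<close> so that it is
  orthogonal to the dual vectors that are already there, find a \<open>w\<close> which detects the corrected
  vector, and project \<open>w\<close> to the orthogonal complement of \<open>S\<close>.
\<close>

lemma dual_family_exists:
  assumes "finite S" "independent S" and W: "subspace W"
    and "\<And>x. x \<in> span S \<Longrightarrow> x \<noteq> 0 \<Longrightarrow> \<exists>w\<in>W. b x w \<noteq> 0"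
  shows "\<exists>d. \<forall>u\<in>S. d u \<in> W \<and> (\<forall>v\<in>S. b v (d u) = (if v = u then 1 else 0))"
  using assms(1,2,4)
proof (induction S rule: finite_induct)
  case empty
  then show ?case by simp
next
  case (insert s S)
  have indep: "independent S" and s: "s \<notin> span S"
    using insert.prems(1) insert.hyps by (auto simp: independent_insert)
  have "\<exists>d. \<forall>u\<in>S. d u \<in> W \<and> (\<forall>v\<in>S. b v (d u) = (if v = u then 1 else 0))"
  proof (rule insert.IH[OF indep])
    fix x assume "x \<in> span S" "x \<noteq> 0"
    then show "\<exists>w\<in>W. b x w \<noteq> 0"
      using insert.prems(2) span_mono[OF subset_insertI, of S s] by blast
  qed
  then obtain d where dW: "\<And>u. u \<in> S \<Longrightarrow> d u \<in> W"
    and d: "\<And>u v. u \<in> S \<Longrightarrow> v \<in> S \<Longrightarrow> b v (d u) = (if v = u then 1 else 0)"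
    by blast
  define t where "t = s - (\<Sum>u\<in>S. scale (b s (d u)) u)"
  have "(\<Sum>u\<in>S. scale (b s (d u)) u) \<in> span S"
    by (intro span_sum span_scale span_base)
  then have "t \<noteq> 0" "t \<in> span (insert s S)"
    using s span_mono[OF subset_insertI, of S s]
    unfolding t_def by (metis eq_iff_diff_eq_0, blast intro: span_diff span_base)
  then obtain w where w: "w \<in> W" "b t w \<noteq> 0" using insert.prems(2) by blast
  define w' where "w' = w - (\<Sum>u\<in>S. scale (b u w) (d u))"
  have w'W: "w' \<in> W"
    unfolding w'_def using w W dW by (intro subspace_diff subspace_sum subspace_scale) auto
  have w'0: "b v w' = 0" if "v \<in> S" for v
  proof -
    have "(\<Sum>u\<in>S. b v (scale (b u w) (d u))) = (\<Sum>u\<in>S. if u = v then b v w else 0)"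
      using d that by (intro sum.cong) (auto simp: bilinear_simps)
    then show ?thesis using that insert.hyps by (simp add: w'_def bilinear_simps sum_right)
  qed
  (* the two corrections are adjoint: pairing s with the projected w moves the projection to s *)
  have "b s w' = b t w"
    by (simp add: w'_def t_def bilinear_simps sum_right sum_left mult.commute)
  then have w's: "b s w' \<noteq> 0" using w by simp
  define e where "e = scale (inverse (b s w')) w'"
  have eW: "e \<in> W" unfolding e_def using W w'W by (rule subspace_scale)
  have es: "b s e = 1" using w's by (simp add: e_def bilinear_simps)
  have e0: "b v e = 0" if "v \<in> S" for v using w'0[OF that] by (simp add: e_def bilinear_simps)
  define d' where "d' u = (if u = s then e else d u - scale (b s (d u)) e)" for u
  have "d' u \<in> W \<and> (\<forall>v\<in>insert s S. b v (d' u) = (if v = u then 1 else 0))"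
    if "u \<in> insert s S" for u
    using that insert.hyps(2) eW es e0 d dW W
    by (auto simp: d'_def bilinear_simps intro!: subspace_diff subspace_scale)
  then show ?case by blast
qed

end

section \<open>The complexified polarisation\<close>

lemma bilinear_form_bilin_ext:
  assumes "bilinear Q"
  shows "bilinear_form cscale (bilin_ext Q)"
proof -
  have Q: "Q (x + y) z = Q x z + Q y z" "Q z (x + y) = Q z x + Q z y"
    "Q (x - y) z = Q x z - Q y z" "Q z (x - y) = Q z x - Q z y"
    "Q (c *\<^sub>R x) z = c * Q x z" "Q z (c *\<^sub>R x) = c * Q z x" for x y z c
    using assms by (simp_all add: bilinear_ladd bilinear_radd bilinear_lsub bilinear_rsub
        bilinear_lmul bilinear_rmul)
  show ?thesis
    by unfold_locales
      (auto simp: bilin_ext_def cscale_def complex_eq_iff Q algebra_simps)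
qed

locale even_polarised_hodge_structure =
  fixes n :: int
    and H :: "int \<Rightarrow> int \<Rightarrow> ('v::real_vector \<times> 'v) set"
    and Q :: "'v \<Rightarrow> 'v \<Rightarrow> real"
  assumes fin: "fin_dim TYPE('v)"
    and even_weight: "even n"
    and hodge: "hodge_structure n H"
    and effective: "effective n H"
    and pol: "polarisation n H Q"
begin

abbreviation V :: "int \<Rightarrow> ('v \<times> 'v) set" where "V i \<equiv> H (n - i) i"

abbreviation \<beta> :: "'v \<times> 'v \<Rightarrow> 'v \<times> 'v \<Rightarrow> complex" where "\<beta> \<equiv> bilin_ext Q"

sublocale bilinear_form cscale \<beta>
  using pol by (intro bilinear_form_bilin_ext) (simp add: polarisation_def)

lemma form_sym: "\<beta> z w = \<beta> w z"
proof -
  have "Q y x = Q x y" for x y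
    using pol even_weight by (simp add: polarisation_def power_int_minus_left)
  then show ?thesis by (simp add: bilin_ext_def complex_eq_iff)
qed

lemma subspace_V: "cplx.subspace (V i)"
  using hodge by (simp add: hodge_structure_def)

lemma conj_V: "z \<in> V i \<Longrightarrow> cconj z \<in> V (n - i)"
proof -
  assume "z \<in> V i"
  moreover have "cconj ` V i = H i (n - i)"
    using hodge unfolding hodge_structure_def by simp
  ultimately show "cconj z \<in> V (n - i)" by auto
qed

lemma form_conj_nonzero: "z \<in> V i \<Longrightarrow> z \<noteq> 0 \<Longrightarrow> \<beta> z (cconj z) \<noteq> 0"
proof
  assume z: "z \<in> V i" "z \<noteq> 0" and zero: "\<beta> z (cconj z) = 0"
  have "\<forall>a b. a + b = n \<longrightarrow> (\<forall>z\<in>H a b. z \<noteq> 0 \<longrightarrow>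
      Re (\<i> powi (a - b) * \<beta> z (cconj z)) > 0)"
    using pol unfolding polarisation_def by simp
  then have "Re (\<i> powi (n - i - i) * \<beta> z (cconj z)) > 0"
    using z by (metis diff_add_cancel)
  then show False using zero by simp
qed

lemma form_orthogonal: "z \<in> V i \<Longrightarrow> w \<in> V j \<Longrightarrow> i + j \<noteq> n \<Longrightarrow> \<beta> z w = 0"
proof -
  assume a: "z \<in> V i" "w \<in> V j" "i + j \<noteq> n"
  have "n - i + i = n \<and> n - j + j = n \<and> (n - j, j) \<noteq> (i, n - i)" using a by auto
  moreover have "\<forall>a b c d. a + b = n \<and> c + d = n \<and> (c, d) \<noteq> (b, a) \<longrightarrow>
      (\<forall>z\<in>H a b. \<forall>w\<in>H c d. \<beta> z w = 0)"
    using pol unfolding polarisation_def by simp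
  ultimately show "\<beta> z w = 0" using a by blast
qed

lemma V_outside: "i < 0 \<or> n < i \<Longrightarrow> V i = {0}"
  using effective by (auto simp: effective_def)

lemma decomposition:
  obtains c where "\<And>i. c i \<in> V i" "finite {i. c i \<noteq> 0}" "z = (\<Sum>i | c i \<noteq> 0. c i)"
proof -
  obtain c where c: "\<And>a. c a \<in> H a (n - a)" "finite {a. c a \<noteq> 0}" "z = (\<Sum>a | c a \<noteq> 0. c a)"
  proof -
    have "\<forall>z. \<exists>!c. (\<forall>a. c a \<in> H a (n - a)) \<and> finite {a. c a \<noteq> 0} \<and> z = (\<Sum>a | c a \<noteq> 0. c a)"
      using hodge unfolding hodge_structure_def by simp
    then have "\<exists>!c. (\<forall>a. c a \<in> H a (n - a)) \<and> finite {a. c a \<noteq> 0} \<and> z = (\<Sum>a | c a \<noteq> 0. c a)"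
      by (rule spec)
    then show ?thesis using that by (auto elim!: ex1E)
  qed
  have bij: "bij_betw (\<lambda>i. n - i) {i. c (n - i) \<noteq> 0} {a. c a \<noteq> 0}"
    by (rule bij_betwI[where g = "\<lambda>i. n - i"]) auto
  show ?thesis
  proof (rule that[of "\<lambda>i. c (n - i)"])
    show "c (n - i) \<in> V i" for i using c(1)[of "n - i"] by simp
    show "finite {i. c (n - i) \<noteq> 0}" using bij_betw_finite[OF bij] c(2) by simp
    show "z = (\<Sum>i | c (n - i) \<noteq> 0. c (n - i))"
      using sum.reindex_bij_betw[OF bij, of c] c(3) by simp
  qed
qed

text \<open>
  If a component \<open>c i\<close> of \<open>y\<close> is nonzero, its conjugate lies in \<open>V (n - i)\<close>. It is therefore
  orthogonal to all the other components of \<open>y\<close>, and positivity makes its product with \<open>c i\<close>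
  nonzero.
\<close>

lemma form_nondegenerate:
  assumes "\<And>z. \<beta> z y = 0"
  shows "y = 0"
proof -
  obtain c where c: "\<And>i. c i \<in> V i" "finite {i. c i \<noteq> 0}" "y = (\<Sum>i | c i \<noteq> 0. c i)"
    using decomposition[of y] by blast
  have "c i = 0" for i
  proof (rule ccontr)
    assume i: "c i \<noteq> 0"
    have "\<beta> (cconj (c i)) y = (\<Sum>j | c j \<noteq> 0. \<beta> (cconj (c i)) (c j))"
      by (subst c(3)) (rule sum_right)
    also have "\<dots> = (\<Sum>j | c j \<noteq> 0. if j = i then \<beta> (cconj (c i)) (c i) else 0)"
      by (intro sum.cong refl) (auto intro!: form_orthogonal[OF conj_V[OF c(1)] c(1)])
    also have "\<dots> = \<beta> (c i) (cconj (c i))" using i c(2) by (simp add: form_sym)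
    finally show False using form_conj_nonzero[OF c(1) i] assms by simp
  qed
  then show ?thesis using c(3) by simp
qed

lemma complexification_finite_dim: "\<exists>B. finite B \<and> cplx.span B = (UNIV :: ('v \<times> 'v) set)"
proof -
  obtain B :: "'v set" where B: "finite B" "span B = UNIV" using fin by (auto simp: fin_dim_def)
  let ?C = "(\<lambda>x. (x, 0 :: 'v)) ` B"
  have re: "(x, 0) \<in> cplx.span ?C" for x
  proof -
    have "x \<in> span B" using B by simp
    then show ?thesis
    proof (induction rule: span_induct_alt)
      case base
      then show ?case using cplx.span_zero[of ?C] by (simp add: zero_prod_def)
    next
      case (step c x y)
      have "(c *\<^sub>R x + y, 0) = cscale (complex_of_real c) (x, 0) + (y, 0)"
        by (simp add: cscale_def)
      moreover have "(x, 0) \<in> cplx.span ?C" using step by (auto intro: cplx.span_base)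
      ultimately show ?case using step by (simp only: cplx.span_add cplx.span_scale)
    qed
  qed
  have "(x, y) \<in> cplx.span ?C" for x y
  proof -
    have "(x, y) = (x, 0) + cscale \<i> (y, 0)" by (simp add: cscale_def)
    then show ?thesis using re by (auto intro!: cplx.span_add cplx.span_scale)
  qed
  then have "cplx.span ?C = UNIV" by auto
  then show ?thesis using B(1) by blast
qed

definition dual_basis :: "int \<Rightarrow> ('v \<times> 'v) set \<Rightarrow> ('v \<times> 'v \<Rightarrow> 'v \<times> 'v) \<Rightarrow> bool" where
  "dual_basis i B d \<longleftrightarrow>
     finite B \<and> B \<subseteq> V i \<and> V i \<subseteq> cplx.span B \<and> card B = hodge_number n H i \<and> 0 \<notin> B \<and>
     (\<forall>u\<in>B. d u \<in> V (n - i) \<and> (\<forall>v\<in>B. \<beta> v (d u) = (if v = u then 1 else 0)))"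

text \<open>Conjugation maps \<open>V i\<close> to \<open>V (n - i)\<close>, so positivity shows that \<open>V (n - i)\<close> separates \<open>V i\<close>.\<close>

lemma dual_basis_exists: "\<exists>B d. dual_basis i B d"
proof -
  obtain B where B: "B \<subseteq> V i" "cplx.independent B" "V i \<subseteq> cplx.span B" "card B = cplx.dim (V i)"
    by (rule cplx.basis_exists)
  obtain C :: "('v \<times> 'v) set" where "finite C" "cplx.span C = UNIV" using complexification_finite_dim by blast
  then have finB: "finite B" using cplx.independent_span_bound[of C B] B by simp
  have span: "cplx.span B \<subseteq> V i" using B(1) subspace_V by (rule cplx.span_minimal)
  have "\<exists>d. \<forall>u\<in>B. d u \<in> V (n - i) \<and> (\<forall>v\<in>B. \<beta> v (d u) = (if v = u then 1 else 0))"
  proof (rule dual_family_exists[OF finB B(2) subspace_V])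
    fix x assume "x \<in> cplx.span B" "x \<noteq> 0"
    then show "\<exists>w\<in>V (n - i). \<beta> x w \<noteq> 0"
      using span conj_V form_conj_nonzero by blast
  qed
  then obtain d where d: "\<forall>u\<in>B. d u \<in> V (n - i) \<and> (\<forall>v\<in>B. \<beta> v (d u) = (if v = u then 1 else 0))"
    by (rule exE)
  have "0 \<notin> B" using B(2) cplx.dependent_zero by blast
  then show ?thesis
    using finB B d unfolding dual_basis_def hodge_number_def
    by (intro exI[of _ B] exI[of _ d] conjI)
qed

definition adapted_basis ::
  "('v \<times> 'v) set \<Rightarrow> ('v \<times> 'v \<Rightarrow> int) \<Rightarrow> ('v \<times> 'v \<Rightarrow> 'v \<times> 'v) \<Rightarrow> bool" where
  "adapted_basis E deg d \<longleftrightarrow>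
     finite E \<and> cplx.span E = UNIV \<and>
     (\<forall>u\<in>E. u \<in> V (deg u) \<and> d u \<in> V (n - deg u)) \<and>
     (\<forall>u\<in>E. \<forall>v\<in>E. \<beta> u (d v) = (if u = v then 1 else 0)) \<and>
     (\<forall>i. card {u\<in>E. deg u = i} = hodge_number n H i)"

lemma adapted_basisD:
  assumes "adapted_basis E deg d"
  shows "finite E" "cplx.span E = UNIV"
    and "u \<in> E \<Longrightarrow> u \<in> V (deg u)"
    and "u \<in> E \<Longrightarrow> d u \<in> V (n - deg u)"
    and "u \<in> E \<Longrightarrow> v \<in> E \<Longrightarrow> \<beta> u (d v) = (if u = v then 1 else 0)"
    and "card {u\<in>E. deg u = i} = hodge_number n H i"
  using assms unfolding adapted_basis_def by simp_all

text \<open>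
  The bases of the \<open>V i\<close> are glued together. They are disjoint because a vector \<open>u\<close> in the bases of
  both \<open>V i\<close> and \<open>V j\<close> pairs to \<open>1\<close> with its dual vector in \<open>V (n - j)\<close>, although \<open>V i\<close> is orthogonal
  to \<open>V (n - j)\<close> for \<open>i \<noteq> j\<close>. For the same reason the dual families remain dual across degrees.
\<close>

lemma adapted_basis_exists: "\<exists>E deg d. adapted_basis E deg d"
proof -
  have "\<forall>i. \<exists>B d. dual_basis i B d"
    using dual_basis_exists by simp
  from choice[OF this] obtain B where "\<forall>i. \<exists>d. dual_basis i (B i) d" ..
  from choice[OF this] obtain d where X: "\<forall>i. dual_basis i (B i) (d i)" ..
  have B_d: "finite (B i) \<and> B i \<subseteq> V i \<and> V i \<subseteq> cplx.span (B i) \<and> card (B i) = hodge_number n H i \<and>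
      0 \<notin> B i \<and> (\<forall>u\<in>B i. d i u \<in> V (n - i) \<and> (\<forall>v\<in>B i. \<beta> v (d i u) = (if v = u then 1 else 0)))" for i
    using X[THEN spec, of i] unfolding dual_basis_def .
  have B: "finite (B i)" "B i \<subseteq> V i" "V i \<subseteq> cplx.span (B i)" "card (B i) = hodge_number n H i"
      "0 \<notin> B i" for i
    using B_d[of i] by simp_all
  have dV: "d i u \<in> V (n - i)" if "u \<in> B i" for i u
    using B_d[of i] that by blast
  have d: "\<beta> v (d i u) = (if v = u then 1 else 0)" if "u \<in> B i" "v \<in> B i" for i u v
    using B_d[of i] that by blast
  have disj: "i = j" if "u \<in> B i" "u \<in> B j" for u i j
  proof (rule ccontr)
    assume "i \<noteq> j"
    then have "\<beta> u (d j u) = 0"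
      using that B(2) dV by (intro form_orthogonal[of u i "d j u" "n - j"]) auto
    then show False using d[OF that(2) that(2)] by simp
  qed
  have empty: "B i = {}" if "i < 0 \<or> n < i" for i
    using V_outside[OF that] B(2,5)[of i] by auto
  define E where "E = (\<Union>i\<in>{0..n}. B i)"
  define deg where "deg u = (THE i. u \<in> B i)" for u
  have BE: "B i \<subseteq> E" for i using empty[of i] by (cases "i < 0 \<or> n < i") (force simp: E_def)+
  have deg: "deg u = i" if "u \<in> B i" for u i
    unfolding deg_def using that disj by blast
  have E: "u \<in> B (deg u)" if "u \<in> E" for u
    using that deg unfolding E_def by blast
  have "adapted_basis E deg (\<lambda>u. d (deg u) u)"
    unfolding adapted_basis_def
  proof (intro conjI ballI allI)
    show "finite E" using B(1) by (simp add: E_def)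
    have "z \<in> cplx.span E" for z
    proof -
      obtain c where c: "\<And>i. c i \<in> V i" "finite {i. c i \<noteq> 0}" "z = (\<Sum>i | c i \<noteq> 0. c i)"
        using decomposition[of z] by blast
      have "c i \<in> cplx.span E" for i using c(1) B(3) cplx.span_mono[OF BE] by (meson subsetD)
      then show ?thesis unfolding c(3) by (intro cplx.span_sum)
    qed
    then show "cplx.span E = UNIV" by auto
    show "u \<in> V (deg u)" and "d (deg u) u \<in> V (n - deg u)" if "u \<in> E" for u
      using E[OF that] B(2) dV by auto
    show "\<beta> u (d (deg v) v) = (if u = v then 1 else 0)" if "u \<in> E" "v \<in> E" for u v
    proof (cases "deg u = deg v")
      case True
      then show ?thesis using d[of v "deg v" u] E that by metis
    next
      case False
      then have "\<beta> u (d (deg v) v) = 0"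
        using E[OF that(1)] E[OF that(2)] B(2) dV
        by (intro form_orthogonal[of u "deg u" _ "n - deg v"]) auto
      then show ?thesis using False by auto
    qed
    have "{u \<in> E. deg u = i} = B i" for i using E deg BE by blast
    then show "card {u \<in> E. deg u = i} = hodge_number n H i" for i using B(4) by simp
  qed
  then show ?thesis by blast
qed

section \<open>Elementary infinitesimal isometries\<close>

text \<open>The action of the bivector \<open>u \<and> v\<close> under the isomorphism of \<open>\<Lambda>\<^sup>2\<close> with the Lie algebra.\<close>

definition wedge :: "'v \<times> 'v \<Rightarrow> 'v \<times> 'v \<Rightarrow> 'v \<times> 'v \<Rightarrow> 'v \<times> 'v" where
  "wedge u v x = cscale (\<beta> u x) v - cscale (\<beta> v x) u"

lemma wedge_isom_component:
  assumes u: "u \<in> V i" and v: "v \<in> V j" and ij: "i + j = n + p"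
  shows "wedge u v \<in> isom_component n H Q p"
proof -
  have "Vector_Spaces.linear cscale cscale (wedge u v)"
    by (auto simp: Vector_Spaces.linear_iff cplx.vector_space_axioms wedge_def bilinear_simps
        cplx.scale_left_distrib cplx.scale_right_diff_distrib)
  moreover have "\<beta> (wedge u v z) w + \<beta> z (wedge u v w) = 0" for z w
    by (simp add: wedge_def bilinear_simps form_sym[of z])
  moreover have "wedge u v x \<in> V (k + p)" if x: "x \<in> V k" for x k
  proof -
    have "cscale (\<beta> u x) v \<in> V (k + p)"
    proof (cases "i + k = n")
      case True
      then have "k + p = j" using ij by simp
      then show ?thesis using v subspace_V cplx.subspace_scale by blast
    next
      case False
      then show ?thesis using form_orthogonal[OF u x] subspace_V cplx.subspace_0 by auto
    qed
    moreover have "cscale (\<beta> v x) u \<in> V (k + p)"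
    proof (cases "j + k = n")
      case True
      then have "k + p = i" using ij by simp
      then show ?thesis using u subspace_V cplx.subspace_scale by blast
    next
      case False
      then show ?thesis using form_orthogonal[OF v x] subspace_V cplx.subspace_0 by auto
    qed
    ultimately show ?thesis unfolding wedge_def using subspace_V cplx.subspace_diff by blast
  qed
  moreover have "H (a - p) (c + p) = V (c + p)" if "a + c = n" for a c
    using that by (simp flip: that)
  ultimately show ?thesis
    unfolding isom_component_def isom_algebra_def mem_Collect_eq image_subset_iff
    by (metis add_diff_cancel_right')
qed

text \<open>
  Expanding first \<open>x\<close> in the basis \<open>d u\<close> and then \<open>g (d u)\<close> in the basis \<open>v\<close> writes \<open>g x\<close> as the sum of
  \<open>a u v * \<beta> u x\<close> times \<open>v\<close> with \<open>a u v = \<beta> (g (d u)) (d v)\<close>. This matrix is skew because \<open>g\<close> is an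
  infinitesimal isometry, and it vanishes unless \<open>deg u + deg v = n + p\<close> because \<open>g\<close> has degree \<open>p\<close>.
  Since \<open>n + p\<close> is odd, no entry has \<open>deg u = deg v\<close>, so the entries \<open>(u, v)\<close> and \<open>(v, u)\<close> combine to
  the multiple \<open>a u v\<close> of an elementary isometry.
\<close>

theorem dim_isom_component_eq_pairs:
  assumes p: "odd p"
    and basis: "adapted_basis E deg d"
  shows "cfun.dim (isom_component n H Q p) =
    card {(u, v) \<in> E \<times> E. deg u < deg v \<and> deg u + deg v = n + p}"
    (is "_ = card ?P")
proof (rule cfun.dim_eq_card_of_coordinates[where r = "\<lambda>(u, v). wedge u v"
      and \<phi> = "\<lambda>(u, v) g. \<beta> (g (d u)) (d v)"])
  note finE = adapted_basisD(1)[OF basis] and spanE = adapted_basisD(2)[OF basis]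
    and EV = adapted_basisD(3)[OF basis] and dV = adapted_basisD(4)[OF basis]
    and d = adapted_basisD(5)[OF basis]
  show finP: "finite ?P"
    by (rule finite_subset[of _ "E \<times> E"]) (use finE in auto)
  show "(case i of (u, v) \<Rightarrow> wedge u v) \<in> isom_component n H Q p" if "i \<in> ?P" for i
    using that EV by (auto intro!: wedge_isom_component)
  show "Vector_Spaces.linear fscale (*) (case i of (u, v) \<Rightarrow> \<lambda>g. \<beta> (g (d u)) (d v))" for i
    by (auto simp: Vector_Spaces.linear_iff cfun.vector_space_axioms fscale_def bilinear_simps
        vector_space_over_itself.vector_space_axioms split: prod.split)
  show "(case i of (u, v) \<Rightarrow> \<lambda>g. \<beta> (g (d u)) (d v)) (case j of (u, v) \<Rightarrow> wedge u v) =
      (if i = j then 1 else 0)" if "i \<in> ?P" "j \<in> ?P" for i j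
  proof -
    obtain u v where i: "i = (u, v)" by (cases i)
    obtain s t where j: "j = (s, t)" by (cases j)
    note ij = i j
    have E: "u \<in> E" "v \<in> E" "s \<in> E" "t \<in> E"
      and "deg u < deg v" "deg s < deg t" using that ij by auto
    then have "\<not> (s = v \<and> t = u)" by auto
    then show ?thesis using E by (auto simp: ij wedge_def bilinear_simps d)
  qed
  show "isom_component n H Q p \<subseteq> cfun.span ((\<lambda>(u, v). wedge u v) ` ?P)"
  proof
    fix g assume g: "g \<in> isom_component n H Q p"
    then have lin: "Vector_Spaces.linear cscale cscale g"
      and skew: "\<beta> (g z) w + \<beta> z (g w) = 0" for z w
      using g unfolding isom_component_def isom_algebra_def by blast+
    then have hom: "module_hom cscale cscale g" by (simp add: Vector_Spaces.linear_def)
    have gV: "g x \<in> V (k + p)" if "x \<in> V k" for x k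
    proof -
      have "g ` H (n - k) k \<subseteq> H (n - k - p) (k + p)" using g by (auto simp: isom_component_def)
      then show ?thesis using that by (auto simp: algebra_simps)
    qed
    (* nondegeneracy turns the duality of E and d into expansions in either family *)
    have expand: "x = (\<Sum>u\<in>E. cscale (\<beta> u x) (d u))" for x
    proof -
      let ?y = "x - (\<Sum>u\<in>E. cscale (\<beta> u x) (d u))"
      have "\<beta> v ?y = 0" if "v \<in> E" for v
      proof -
        have "(\<Sum>u\<in>E. \<beta> v (cscale (\<beta> u x) (d u))) = (\<Sum>u\<in>E. if u = v then \<beta> v x else 0)"
          using d that by (intro sum.cong) (auto simp: bilinear_simps)
        then show ?thesis using that finE by (simp add: bilinear_simps sum_right)
      qed
      then have "\<beta> z ?y = 0" for z using zero_on_span[of E ?y z] spanE by simp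
      then show ?thesis using form_nondegenerate[of ?y] by simp
    qed
    have expand': "x = (\<Sum>v\<in>E. cscale (\<beta> x (d v)) v)" for x
    proof -
      let ?y = "x - (\<Sum>v\<in>E. cscale (\<beta> x (d v)) v)"
      have *: "\<beta> ?y (d w) = 0" if "w \<in> E" for w
      proof -
        have "(\<Sum>v\<in>E. \<beta> (cscale (\<beta> x (d v)) v) (d w)) = (\<Sum>v\<in>E. if v = w then \<beta> x (d w) else 0)"
          using d that by (intro sum.cong) (auto simp: bilinear_simps)
        then show ?thesis using that finE by (simp add: bilinear_simps sum_left)
      qed
      have "\<beta> z ?y = 0" for z
      proof -
        have "\<beta> ?y z = (\<Sum>u\<in>E. \<beta> ?y (cscale (\<beta> u z) (d u)))"
          by (subst expand[of z]) (rule sum_right)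
        also have "\<dots> = 0" using * by (intro sum.neutral) (simp add: scale_right)
        finally show ?thesis by (simp add: form_sym)
      qed
      then show ?thesis using form_nondegenerate[of ?y] by simp
    qed
    define a where "a u v = \<beta> (g (d u)) (d v)" for u v
    have a_skew: "a v u = - a u v" for u v
      using skew[of "d u" "d v"] form_sym[of "d u" "g (d v)"]
      by (simp add: a_def eq_neg_iff_add_eq_0 add.commute)
    have a0: "a u v = 0" if "u \<in> E" "v \<in> E" "deg u + deg v \<noteq> n + p" for u v
      unfolding a_def
      by (rule form_orthogonal[OF gV[OF dV] dV]) (use that in auto)
    let ?P' = "{(u, v) \<in> E \<times> E. deg v < deg u \<and> deg u + deg v = n + p}"
    have finP': "finite ?P'"
      by (rule finite_subset[of _ "E \<times> E"]) (use finE in auto)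
    have "g x = (\<Sum>(u, v)\<in>?P. cscale (a u v) (wedge u v x))" for x
    proof -
      let ?t = "\<lambda>(u, v). cscale (\<beta> u x * a u v) v"
      have "g x = (\<Sum>u\<in>E. cscale (\<beta> u x) (g (d u)))"
        by (subst expand[of x]) (simp add: module_hom.sum[OF hom] module_hom.scale[OF hom])
      also have "\<dots> = (\<Sum>u\<in>E. cscale (\<beta> u x) (\<Sum>v\<in>E. cscale (a u v) v))"
        unfolding a_def by (intro sum.cong refl arg_cong[where f = "cscale _"] expand')
      also have "\<dots> = (\<Sum>q\<in>E \<times> E. ?t q)"
        by (simp add: cplx.scale_sum_right sum.cartesian_product)
      also have "\<dots> = (\<Sum>q\<in>?P \<union> ?P'. ?t q)"
      proof (rule sum.mono_neutral_right)
        show "\<forall>q\<in>E \<times> E - (?P \<union> ?P'). ?t q = 0"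
        proof
          fix q assume q: "q \<in> E \<times> E - (?P \<union> ?P')"
          obtain u v where uv: "q = (u, v)" by (cases q)
          have "deg u + deg v \<noteq> n + p"
          proof
            assume eq: "deg u + deg v = n + p"
            then have "deg u = deg v" using q uv by auto
            with eq have "n + p = 2 * deg u" by simp
            then show False using p even_weight by presburger
          qed
          then show "?t q = 0" using q uv a0 by auto
        qed
      qed (use finE in auto)
      also have "\<dots> = (\<Sum>q\<in>?P. ?t q) + (\<Sum>q\<in>?P'. ?t q)"
        using finP finP' by (intro sum.union_disjoint) auto
      also have "(\<Sum>q\<in>?P'. ?t q) = (\<Sum>(u, v)\<in>?P. ?t (v, u))"
        by (rule sum.reindex_bij_witness[of _ prod.swap prod.swap]) (auto simp: add.commute)
      also have "(\<Sum>q\<in>?P. ?t q) + (\<Sum>(u, v)\<in>?P. ?t (v, u)) =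
          (\<Sum>(u, v)\<in>?P. cscale (a u v) (wedge u v x))"
        unfolding sum.distrib[symmetric]
      proof (rule sum.cong[OF refl])
        fix q assume "q \<in> ?P"
        obtain u v where q: "q = (u, v)" by (cases q)
        show "?t q + (case q of (u, v) \<Rightarrow> ?t (v, u)) = (case q of (u, v) \<Rightarrow> cscale (a u v) (wedge u v x))"
          by (simp add: q wedge_def a_skew[of u v] cplx.scale_right_diff_distrib mult.commute)
      qed
      finally show ?thesis .
    qed
    then have "g = (\<Sum>(u, v)\<in>?P. fscale (a u v) (wedge u v))"
      by (auto simp: fun_eq_iff sum_fun_apply fscale_def split_beta)
    also have "\<dots> \<in> cfun.span ((\<lambda>(u, v). wedge u v) ` ?P)"
    proof (rule cfun.span_sum)
      fix q assume "q \<in> ?P"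
      then have "(\<lambda>(u, v). wedge u v) q \<in> (\<lambda>(u, v). wedge u v) ` ?P" by (rule imageI)
      then show "(case q of (u, v) \<Rightarrow> fscale (a u v) (wedge u v)) \<in> cfun.span ((\<lambda>(u, v). wedge u v) ` ?P)"
        unfolding split_beta by (intro cfun.span_scale cfun.span_base)
    qed
    finally show "g \<in> cfun.span ((\<lambda>(u, v). wedge u v) ` ?P)" .
  qed
qed

section \<open>Hodge symmetry and counting by degree\<close>

text \<open>
  The vectors dual to a basis of \<open>V i\<close> span \<open>V (n - i)\<close>: subtracting from \<open>x \<in> V (n - i)\<close> its
  expansion leaves a vector orthogonal to \<open>V i\<close>, in particular to its own conjugate.
\<close>

lemma hodge_number_le: "hodge_number n H (n - i) \<le> hodge_number n H i"
proof -
  obtain B d where B: "finite B" "B \<subseteq> V i" "V i \<subseteq> cplx.span B" "card B = hodge_number n H i"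
    and d: "\<forall>u\<in>B. d u \<in> V (n - i) \<and> (\<forall>v\<in>B. \<beta> v (d u) = (if v = u then 1 else 0))"
    using dual_basis_exists[of i] unfolding dual_basis_def by auto
  have "V (n - i) \<subseteq> cplx.span (d ` B)"
  proof
    fix x assume x: "x \<in> V (n - i)"
    let ?s = "\<Sum>u\<in>B. cscale (\<beta> u x) (d u)"
    have s: "?s \<in> V (n - i)"
      using d by (intro cplx.subspace_sum[OF subspace_V] cplx.subspace_scale[OF subspace_V]) auto
    have y: "x - ?s \<in> V (n - i)" using x s by (rule cplx.subspace_diff[OF subspace_V])
    have "\<beta> v (x - ?s) = 0" if "v \<in> B" for v
    proof -
      have "(\<Sum>u\<in>B. \<beta> v (cscale (\<beta> u x) (d u))) = (\<Sum>u\<in>B. if u = v then \<beta> v x else 0)"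
        using d that by (intro sum.cong) (auto simp: bilinear_simps)
      then show ?thesis using that B(1) by (simp add: bilinear_simps sum_right)
    qed
    then have "\<beta> z (x - ?s) = 0" if "z \<in> V i" for z
      using zero_on_span[of B "x - ?s" z] B(3) that by blast
    moreover have "cconj (x - ?s) \<in> V i" using conj_V[OF y] by simp
    ultimately have "\<beta> (x - ?s) (cconj (x - ?s)) = 0"
      by (subst form_sym)
    then have "x - ?s = 0"
      using form_conj_nonzero[OF y] by blast
    then have "x = ?s" by simp
    also have "\<dots> \<in> cplx.span (d ` B)"
      by (intro cplx.span_sum cplx.span_scale cplx.span_base) auto
    finally show "x \<in> cplx.span (d ` B)" .
  qed
  then have "cplx.dim (V (n - i)) \<le> card (d ` B)" using B(1) by (intro cplx.dim_le_card) auto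
  also have "\<dots> \<le> card B" using B(1) by (rule card_image_le)
  finally show ?thesis using B(4) by (simp add: hodge_number_def)
qed

lemma hodge_symmetry: "hodge_number n H (n - i) = hodge_number n H i"
  using hodge_number_le[of i] hodge_number_le[of "n - i"] by simp

lemma hodge_number_outside: "i < 0 \<or> n < i \<Longrightarrow> hodge_number n H i = 0"
  using V_outside[of i] cplx.dim_le_card[of "{0}" "{}"] by (simp add: hodge_number_def)

theorem twice_dim_isom_component:
  assumes p: "odd p"
  shows "2 * cfun.dim (isom_component n H Q p) =
    (\<Sum>i\<in>{0..n}. hodge_number n H i * hodge_number n H (n + p - i))"
proof -
  obtain E deg d where basis: "adapted_basis E deg d"
    using adapted_basis_exists by blast
  note finE = adapted_basisD(1)[OF basis] and card = adapted_basisD(6)[OF basis]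
  let ?P = "{(u, v) \<in> E \<times> E. deg u < deg v \<and> deg u + deg v = n + p}"
  let ?P' = "{(u, v) \<in> E \<times> E. deg v < deg u \<and> deg u + deg v = n + p}"
  let ?F = "\<lambda>i. {u \<in> E. deg u = i}"
  have range: "deg u \<in> {0..n}" if "u \<in> E" for u
  proof (rule ccontr)
    assume "deg u \<notin> {0..n}"
    then have "card (?F (deg u)) = 0" using hodge_number_outside card by auto
    then have "?F (deg u) = {}" using finE by simp
    then show False using that by blast
  qed
  have fin: "finite ?P" "finite ?P'"
    by (rule finite_subset[of _ "E \<times> E"]; use finE in auto)+
  have "card ?P' = card ?P"
    by (rule bij_betw_same_card[OF bij_betwI[of prod.swap _ _ prod.swap]]) auto
  then have "2 * card ?P = card ?P + card ?P'" by simp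
  also have "\<dots> = card (?P \<union> ?P')" using fin by (intro card_Un_disjoint[symmetric]) auto
  also have "?P \<union> ?P' = (\<Union>i\<in>{0..n}. ?F i \<times> ?F (n + p - i))"
  proof -
    have "deg u \<noteq> deg v" if "deg u + deg v = n + p" for u v
      using that p even_weight by presburger
    then have "?P \<union> ?P' = {(u, v) \<in> E \<times> E. deg u + deg v = n + p}"
      by (auto simp: neq_iff)
    also have "\<dots> = (\<Union>i\<in>{0..n}. ?F i \<times> ?F (n + p - i))"
    proof (intro equalityI subsetI)
      fix q assume q: "q \<in> {(u, v) \<in> E \<times> E. deg u + deg v = n + p}"
      obtain u v where uv: "q = (u, v)" by (cases q)
      have "deg u \<in> {0..n}" using q uv range by simp
      moreover have "q \<in> ?F (deg u) \<times> ?F (n + p - deg u)" using q uv by simp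
      ultimately show "q \<in> (\<Union>i\<in>{0..n}. ?F i \<times> ?F (n + p - i))" by (rule UN_I)
    qed auto
    finally show ?thesis .
  qed
  also have "card \<dots> = (\<Sum>i\<in>{0..n}. card (?F i \<times> ?F (n + p - i)))"
    using finE by (intro card_UN_disjoint) auto
  finally show ?thesis
    using dim_isom_component_eq_pairs[OF p basis]
    by (simp add: card_cartesian_product card)
qed

theorem dim_isom_component:
  assumes p: "odd p" and "0 < p"
  shows "real (cfun.dim (isom_component n H Q p)) =
    1/2 * (\<Sum>j=0..n-p. real (hodge_number n H (n - p - j)) * real (hodge_number n H j))"
proof -
  let ?f = "hodge_number n H"
  have "(\<Sum>i\<in>{0..n}. ?f i * ?f (n + p - i)) = (\<Sum>i\<in>{p..n}. ?f i * ?f (n + p - i))"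
    using \<open>0 < p\<close> by (intro sum.mono_neutral_right) (auto simp: hodge_number_outside)
  (* j = n - i, after which Hodge symmetry is applied to both factors *)
  also have "\<dots> = (\<Sum>j\<in>{0..n-p}. ?f (n - j) * ?f (p + j))"
    by (rule sum.reindex_bij_witness[of _ "\<lambda>j. n - j" "\<lambda>i. n - i"]) (auto simp: algebra_simps)
  also have "\<dots> = (\<Sum>j\<in>{0..n-p}. ?f (n - p - j) * ?f j)"
  proof (rule sum.cong[OF refl])
    fix j
    show "?f (n - j) * ?f (p + j) = ?f (n - p - j) * ?f j"
      using hodge_symmetry[of j] hodge_symmetry[of "p + j"] by (simp add: algebra_simps)
  qed
  finally have "2 * cfun.dim (isom_component n H Q p) = (\<Sum>j\<in>{0..n-p}. ?f (n - p - j) * ?f j)"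
    using twice_dim_isom_component[OF p] by simp
  then have "2 * real (cfun.dim (isom_component n H Q p)) =
      real (\<Sum>j\<in>{0..n-p}. ?f (n - p - j) * ?f j)"
    by linarith
  then show ?thesis by simp
qed

end

lemma reflected_sum_split:
  fixes f :: "int \<Rightarrow> real" and m p :: int
  assumes "0 < p" "p < m" and sym: "\<And>i. f (2 * m - i) = f i"
  shows "1/2 * (\<Sum>j=0..2*m-p. f (2*m-p-j) * f j) =
    (\<Sum>j=0..m-p-1. f (j + p) * f j) + 1/2 * f m * f (m - p) + 1/2 * f m * f (m - p)
    + 1/2 * (\<Sum>j=m-p+1..m-1. f (2*m-j-p) * f j)"
proof -
  let ?g = "\<lambda>j. f (2*m-p-j) * f j"
  have split: "{0..2*m-p} = insert m (insert (m-p) ({0..m-p-1} \<union> ({m-p+1..m-1} \<union> {m+1..2*m-p})))"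
    using assms by auto
  have disj: "{0..m-p-1} \<inter> ({m-p+1..m-1} \<union> {m+1..2*m-p}) = {}" "{m-p+1..m-1} \<inter> {m+1..2*m-p} = {}"
    using assms by auto
  have "(\<Sum>j=0..2*m-p. ?g j) = ?g m + (?g (m-p) + (sum ?g {0..m-p-1} + (sum ?g {m-p+1..m-1} +
      sum ?g {m+1..2*m-p})))"
    unfolding split using assms by (simp add: sum.union_disjoint[OF _ _ disj(1)] sum.union_disjoint[OF _ _ disj(2)])
  moreover have "sum ?g {m+1..2*m-p} = sum ?g {0..m-p-1}"
    by (rule sum.reindex_bij_witness[of _ "\<lambda>j. 2*m-p-j" "\<lambda>j. 2*m-p-j"]) auto
  moreover have "sum ?g {0..m-p-1} = (\<Sum>j=0..m-p-1. f (j + p) * f j)"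
  proof (rule sum.cong[OF refl])
    fix j
    show "?g j = f (j + p) * f j" using sym[of "j + p"] by (simp add: algebra_simps)
  qed
  moreover have "sum ?g {m-p+1..m-1} = (\<Sum>j=m-p+1..m-1. f (2*m-j-p) * f j)"
    by (intro sum.cong refl) (simp add: algebra_simps)
  ultimately show ?thesis by (simp add: algebra_simps)
qed

theorem corollary17:
  fixes H :: "int \<Rightarrow> int \<Rightarrow> ('v::real_vector \<times> 'v) set"
    and Q :: "'v \<Rightarrow> 'v \<Rightarrow> real"
    and n m p :: int
    and l :: nat
    and f :: "int \<Rightarrow> nat"
  assumes fin: "fin_dim TYPE('v)"
    and dim: "dim (UNIV :: 'v set) = 2 * l"
    and weight: "n = 2 * m"
    and hodge: "hodge_structure n H"
    and effective: "effective n H"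
    and pol: "polarisation n H Q"
    and f: "\<And>i. f i = hodge_number n H i"
    and p: "odd p"
  shows "(0 < p \<and> p < m \<longrightarrow>
           real (cfun.dim (isom_component n H Q p)) =
             (\<Sum>j=0..m-p-1. real (f (j + p)) * real (f j))
             + 1/2 * real (f m) * real (f (m - p))
             + 1/2 * real (f m) * real (f (m - p))
             + 1/2 * (\<Sum>j=m-p+1..m-1. real (f (n - j - p)) * real (f j)))
       \<and> (p > m \<longrightarrow>
           real (cfun.dim (isom_component n H Q p)) =
             1/2 * (\<Sum>j=0..n-p. real (f (n - p - j)) * real (f j)))"
proof -
  interpret even_polarised_hodge_structure n H Q
    using assms by unfold_locales auto
  have sym: "f (2 * m - i) = f i" for i
    using hodge_symmetry[of i] by (simp add: f weight)
  have main: "real (cfun.dim (isom_component n H Q p)) =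
      1/2 * (\<Sum>j=0..n-p. real (f (n - p - j)) * real (f j))" if "0 < p"
    using dim_isom_component[OF p that] by (simp add: f)
  show ?thesis
  proof (intro conjI impI)
    assume range: "0 < p \<and> p < m"
    then have "1/2 * (\<Sum>j=0..n-p. real (f (n - p - j)) * real (f j)) =
        (\<Sum>j=0..m-p-1. real (f (j + p)) * real (f j))
        + 1/2 * real (f m) * real (f (m - p)) + 1/2 * real (f m) * real (f (m - p))
        + 1/2 * (\<Sum>j=m-p+1..m-1. real (f (n - j - p)) * real (f j))"
      unfolding weight by (intro reflected_sum_split) (auto simp: sym)
    then show "real (cfun.dim (isom_component n H Q p)) =
        (\<Sum>j=0..m-p-1. real (f (j + p)) * real (f j))
        + 1/2 * real (f m) * real (f (m - p)) + 1/2 * real (f m) * real (f (m - p))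
        + 1/2 * (\<Sum>j=m-p+1..m-1. real (f (n - j - p)) * real (f j))"
      using main range by simp
  next
    assume "p > m"
    show "real (cfun.dim (isom_component n H Q p)) =
        1/2 * (\<Sum>j=0..n-p. real (f (n - p - j)) * real (f j))"
    proof (cases "0 < p")
      case True
      then show ?thesis by (rule main)
    next
      case False
      (* here the weight is negative and admits no effective Hodge type, so both sides are 0 *)
      then have neg: "n < 0" using \<open>p > m\<close> weight by simp
      then have "f i = 0" for i using hodge_number_outside[of i] by (cases "i < 0") (auto simp: f)
      moreover have "cfun.dim (isom_component n H Q p) = 0"
        using twice_dim_isom_component[OF p] neg by simp
      ultimately show ?thesis by simp
    qed
  qed
qed

end
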